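(* Let $\mathcal{F}=\{\mathcal{A}\mid\mathcal{R}\}$ be a favourable polycyclic presentation (consistent and with all $e_i>1$) with soluble bound $d$ and maximum normal word length $N$. Then every concatenation of two normal words in $\mathcal{A}$ can be collected from the left to a normal word in at most $N^{3d-1}$ steps. All words occurring in the course of this collection have length at most $2N$ when $d=1$, and at most $2(d-1)N^2$ otherwise.
   Context: Polycyclic presentations. A finite polycyclic presentation is a presentation $\{\mathcal{A}\mid\mathcal{R}\}$ where $\mathcal{A}=\{a_1,\dots,a_m\}$ (ordered by $a_1<\dots<a_m$) and $\mathcal{R}$ consists of the relations $a_i^{e_i}=v_{ii}$ for $1\le i\le m$ and $a_ja_i=a_iv_{ij}$ for $1\le i<j\le m$, where each $e_i$ is a positive integer and $v_{ij}$ is a word in $\{a_{i+1},\dots,a_m\}$ for $1\le i\le j\le m$. Only non-negative words are considered (words in letters of $\mathcal{A}$, without inverses; the empty word is allowed). The normal words in $\mathcal{A}$ are the words $a_1^{\alpha_1}\cdots a_m^{\alpha_m}$ with integers $0\le\alpha_i<e_i$; here $a^\alpha$ is the concatenation of $\alpha$ copies of $a$. The right-hand sides of all relations in $\mathcal{R}$ are normal words. The left-hand sides of the relations in $\mathcal{R}$ are the minimal non-normal words. The presentation defines a finite soluble group $G$ of order dividing $e_1\cdots e_m$; it is consistent if $|G|=e_1\cdots e_m$. It is a standing assumption that the presentation is consistent and that all $e_i>1$. The maximum normal word length is $N=(e_1-1)+\dots+(e_m-1)$. Collection. Given a non-normal word, a collection step replaces a minimal non-normal subword (an occurrence of the left-hand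 side of a relation of $\mathcal{R}$ as a contiguous subword) by the right-hand side of that relation. Collecting a word is applying a sequence of collection steps starting at the word. Collection from the left is the collection in which each step replaces the left-most minimal non-normal subword of the current word. Complexity is measured by the number of collection steps; length is word length. Favourable presentations. A finite polycyclic presentation $\{\mathcal{A}\mid\mathcal{R}\}$ is favourable if there are a positive integer $d$ (the soluble bound) and a non-decreasing (with respect to $a_1<\dots<a_m$) surjective function $\delta:\mathcal{A}\to\{1,\dots,d\}$ such that: for each $i$, either $v_{ii}$ is $a_{i+1}$ or $v_{ii}$ is a normal word in $\{a_k,\dots,a_m\}$ with $\delta(a_k)>\delta(a_i)$; and for $j>i$ each $v_{ij}$ is a normal word equal either to $v^*_{ij}$ or to $a_jv^*_{ij}$, where $v^*_{ij}$ is a normal word in $\{a_k,\dots,a_m\}$ with $\delta(a_k)>\delta(a_i)$. (Thus the normal words $v_{ii}$ of the second kind and $v^*_{ij}$ involve only generators of $\delta$-value greater than $\delta(a_i)$, and may be empty.) *)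

theory Defs
  imports "HOL-Algebra.Coset"
begin

section \<open>The group defined by a presentation\<close>

text \<open>
  The letter \<open>(x, True)\<close> stands for the generator \<open>x\<close> and \<open>(x, False)\<close> for its formal inverse.
  The group presented by generators \<open>X\<close> and relations \<open>R\<close> (pairs of words without inverses) is
  the set of words in these letters modulo the least congruence that makes the two kinds of
  letters mutually inverse and contains \<open>R\<close>.
\<close>

definition pos_word :: "'a list \<Rightarrow> ('a \<times> bool) list" where
  "pos_word w = map (\<lambda>x. (x, True)) w"

inductive_set pres_cong ::
  "'a set \<Rightarrow> ('a list \<times> 'a list) set \<Rightarrow> (('a \<times> bool) list \<times> ('a \<times> bool) list) set"
  for X :: "'a set" and R :: "('a list \<times> 'a list) set"
where
  refl: "w \<in> lists (X \<times> UNIV) \<Longrightarrow> (w, w) \<in> pres_cong X R"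
| sym: "(u, w) \<in> pres_cong X R \<Longrightarrow> (w, u) \<in> pres_cong X R"
| trans: "(u, v) \<in> pres_cong X R \<Longrightarrow> (v, w) \<in> pres_cong X R \<Longrightarrow> (u, w) \<in> pres_cong X R"
| append: "(u, u') \<in> pres_cong X R \<Longrightarrow> (w, w') \<in> pres_cong X R \<Longrightarrow> (u @ w, u' @ w') \<in> pres_cong X R"
| cancel: "x \<in> X \<Longrightarrow> ([(x, b), (x, \<not> b)], []) \<in> pres_cong X R"
| relation: "(l, r) \<in> R \<Longrightarrow> l \<in> lists X \<Longrightarrow> r \<in> lists X \<Longrightarrow> (pos_word l, pos_word r) \<in> pres_cong X R"

definition presented_group :: "'a set \<Rightarrow> ('a list \<times> 'a list) set \<Rightarrow> ('a \<times> bool) list set monoid" where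
  "presented_group X R =
    \<lparr>carrier = lists (X \<times> UNIV) // pres_cong X R,
     mult = (\<lambda>A B. \<Union>u\<in>A. \<Union>w\<in>B. pres_cong X R `` {u @ w}),
     one = pres_cong X R `` {[]}\<rparr>"

lemma pres_cong_in_lists:
  "(u, w) \<in> pres_cong X R \<Longrightarrow> u \<in> lists (X \<times> UNIV) \<and> w \<in> lists (X \<times> UNIV)"
  by (induction rule: pres_cong.induct) (auto simp: pos_word_def)

lemma equiv_pres_cong: "equiv (lists (X \<times> UNIV)) (pres_cong X R)"
proof (rule equivI)
  show "pres_cong X R \<subseteq> lists (X \<times> UNIV) \<times> lists (X \<times> UNIV)"
    by (auto dest: pres_cong_in_lists)
  show "refl_on (lists (X \<times> UNIV)) (pres_cong X R)"
    by (auto intro!: refl_onI pres_cong.refl)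
  show "sym (pres_cong X R)"
    by (auto intro!: symI pres_cong.sym)
  show "trans (pres_cong X R)"
    by (rule transI) (rule pres_cong.trans)
qed

lemma presented_group_mult:
  assumes "u \<in> lists (X \<times> UNIV)" "w \<in> lists (X \<times> UNIV)"
  shows "(pres_cong X R `` {u}) \<otimes>\<^bsub>presented_group X R\<^esub> (pres_cong X R `` {w}) = pres_cong X R `` {u @ w}"
proof -
  have "congruent2 (pres_cong X R) (pres_cong X R) (\<lambda>u w. pres_cong X R `` {u @ w})"
    by (auto intro!: congruent2I' equiv_class_eq[OF equiv_pres_cong] pres_cong.append)
  from UN_equiv_class2[OF equiv_pres_cong equiv_pres_cong this assms]
  show ?thesis by (simp add: presented_group_def)
qed

lemma pres_cong_left_inverse:
  "w \<in> lists (X \<times> UNIV) \<Longrightarrow> \<exists>u \<in> lists (X \<times> UNIV). (u @ w, []) \<in> pres_cong X R"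
proof (induction w)
  case Nil
  then show ?case by (intro bexI[of _ "[]"]) (auto intro: pres_cong.refl)
next
  case (Cons a w)
  obtain x b where a: "a = (x, b)" "x \<in> X" using Cons.prems by auto
  obtain u where u: "u \<in> lists (X \<times> UNIV)" "(u @ w, []) \<in> pres_cong X R"
    using Cons by auto
  have "([(x, \<not> b), (x, b)], []) \<in> pres_cong X R"
    using pres_cong.cancel[OF a(2), of "\<not> b"] by simp
  from pres_cong.append[OF pres_cong.refl[OF u(1)] pres_cong.append[OF this pres_cong.refl]]
  have "(u @ [(x, \<not> b), (x, b)] @ w, u @ w) \<in> pres_cong X R"
    using Cons.prems by auto
  then have "((u @ [(x, \<not> b)]) @ a # w, []) \<in> pres_cong X R"
    using pres_cong.trans[OF _ u(2)] a by simp
  then show ?case using u(1) a(2) by (intro bexI[of _ "u @ [(x, \<not> b)]"]) auto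
qed

lemma group_presented_group: "group (presented_group X R)"
proof -
  let ?G = "presented_group X R" and ?c = "\<lambda>w. pres_cong X R `` {w}"
  have carr: "\<And>A. A \<in> carrier ?G \<longleftrightarrow> (\<exists>w \<in> lists (X \<times> UNIV). A = ?c w)"
    by (auto simp: presented_group_def quotient_def)
  have one: "\<one>\<^bsub>?G\<^esub> = ?c []" by (simp add: presented_group_def)
  have app: "u @ w \<in> lists (X \<times> UNIV)"
    if "u \<in> lists (X \<times> UNIV)" "w \<in> lists (X \<times> UNIV)" for u w :: "('a \<times> bool) list"
    using that by auto
  show ?thesis
  proof (rule groupI)
    show "\<one>\<^bsub>?G\<^esub> \<in> carrier ?G" using one carr by blast
  next
    fix A B assume "A \<in> carrier ?G" "B \<in> carrier ?G"
    then show "A \<otimes>\<^bsub>?G\<^esub> B \<in> carrier ?G"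
      unfolding carr using presented_group_mult app by metis
  next
    fix A B C assume "A \<in> carrier ?G" "B \<in> carrier ?G" "C \<in> carrier ?G"
    then obtain u v w where "u \<in> lists (X \<times> UNIV)" "v \<in> lists (X \<times> UNIV)" "w \<in> lists (X \<times> UNIV)"
      "A = ?c u" "B = ?c v" "C = ?c w" unfolding carr by blast
    then show "A \<otimes>\<^bsub>?G\<^esub> B \<otimes>\<^bsub>?G\<^esub> C = A \<otimes>\<^bsub>?G\<^esub> (B \<otimes>\<^bsub>?G\<^esub> C)"
      by (simp only: presented_group_mult app append_assoc)
  next
    fix A assume "A \<in> carrier ?G"
    then obtain w where w: "w \<in> lists (X \<times> UNIV)" "A = ?c w" unfolding carr by blast
    have nil: "[] \<in> lists (X \<times> (UNIV :: bool set))" by simp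
    show "\<one>\<^bsub>?G\<^esub> \<otimes>\<^bsub>?G\<^esub> A = A"
      unfolding one w(2) using presented_group_mult[OF nil w(1)] by simp
    obtain u where u: "u \<in> lists (X \<times> UNIV)" "(u @ w, []) \<in> pres_cong X R"
      using pres_cong_left_inverse[OF w(1)] by blast
    have "?c u \<otimes>\<^bsub>?G\<^esub> A = \<one>\<^bsub>?G\<^esub>"
      unfolding one w(2) presented_group_mult[OF u(1) w(1)]
      using equiv_class_eq[OF equiv_pres_cong u(2)] .
    then show "\<exists>B \<in> carrier ?G. B \<otimes>\<^bsub>?G\<^esub> A = \<one>\<^bsub>?G\<^esub>" using u(1) carr by blast
  qed
qed


section \<open>Polycyclic presentations\<close>

text \<open>
  The generator \<open>a\<^sub>i\<close> is represented by its index \<open>i\<close>, so the alphabet is \<open>{1..m}\<close> with its usual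
  order. A presentation is given by \<open>m\<close>, the exponents \<open>e i\<close> and the words \<open>v i j\<close>; the values of
  \<open>e\<close> and \<open>v\<close> at other arguments are irrelevant.
\<close>

type_synonym word = "nat list"

definition normal_words :: "nat \<Rightarrow> (nat \<Rightarrow> nat) \<Rightarrow> word set" where
  "normal_words m e =
    {concat (map (\<lambda>i. replicate (\<alpha> i) i) [1..<Suc m]) | \<alpha>. \<forall>i\<in>{1..m}. \<alpha> i < e i}"

definition pc_relations :: "nat \<Rightarrow> (nat \<Rightarrow> nat) \<Rightarrow> (nat \<Rightarrow> nat \<Rightarrow> word) \<Rightarrow> (word \<times> word) set" where
  "pc_relations m e v =
    {(replicate (e i) i, v i i) | i. 1 \<le> i \<and> i \<le> m} \<union>
    {([j, i], i # v i j) | i j. 1 \<le> i \<and> i < j \<and> j \<le> m}"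

definition pc_presentation :: "nat \<Rightarrow> (nat \<Rightarrow> nat) \<Rightarrow> (nat \<Rightarrow> nat \<Rightarrow> word) \<Rightarrow> bool" where
  "pc_presentation m e v \<longleftrightarrow>
    (\<forall>i\<in>{1..m}. e i > 0) \<and>
    (\<forall>i j. 1 \<le> i \<and> i \<le> j \<and> j \<le> m \<longrightarrow> set (v i j) \<subseteq> {i+1..m}) \<and>
    (\<forall>(l, r)\<in>pc_relations m e v. r \<in> normal_words m e)"

definition consistent :: "nat \<Rightarrow> (nat \<Rightarrow> nat) \<Rightarrow> (nat \<Rightarrow> nat \<Rightarrow> word) \<Rightarrow> bool" where
  "consistent m e v \<longleftrightarrow>
    order (presented_group {1..m} (pc_relations m e v)) = (\<Prod>i=1..m. e i)"

definition max_normal_length :: "nat \<Rightarrow> (nat \<Rightarrow> nat) \<Rightarrow> nat" where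
  "max_normal_length m e = (\<Sum>i=1..m. (e i - 1))"

definition favourable :: "nat \<Rightarrow> (nat \<Rightarrow> nat) \<Rightarrow> (nat \<Rightarrow> nat \<Rightarrow> word) \<Rightarrow> nat \<Rightarrow> bool" where
  "favourable m e v d \<longleftrightarrow>
    pc_presentation m e v \<and> d > 0 \<and>
    (\<exists>\<delta> :: nat \<Rightarrow> nat.
      mono_on {1..m} \<delta> \<and> \<delta> ` {1..m} = {1..d} \<and>
      (\<forall>i\<in>{1..m}.
        (i < m \<and> v i i = [i + 1]) \<or>
        (v i i \<in> normal_words m e \<and> (\<forall>k\<in>set (v i i). \<delta> k > \<delta> i))) \<and>
      (\<forall>i j. 1 \<le> i \<and> i < j \<and> j \<le> m \<longrightarrow>
        v i j \<in> normal_words m e \<and>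
        (\<exists>v' \<in> normal_words m e.
          (\<forall>k\<in>set v'. \<delta> k > \<delta> i) \<and> (v i j = v' \<or> v i j = j # v'))))"


section \<open>Collection from the left\<close>

text \<open>
  The minimal non-normal words are the left-hand sides of the relations. If all \<open>e i > 1\<close>, none of
  them is a subword of another, so the left-most occurrence is determined by its starting position.
\<close>

definition left_collection_step ::
  "nat \<Rightarrow> (nat \<Rightarrow> nat) \<Rightarrow> (nat \<Rightarrow> nat \<Rightarrow> word) \<Rightarrow> word \<Rightarrow> word \<Rightarrow> bool" where
  "left_collection_step m e v x y \<longleftrightarrow>
    (\<exists>p l r s. (l, r) \<in> pc_relations m e v \<and> x = p @ l @ s \<and> y = p @ r @ s \<and>
      (\<forall>p' l' r' s'. (l', r') \<in> pc_relations m e v \<and> x = p' @ l' @ s' \<longrightarrow> length p \<le> length p'))"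

end

theory Submission
  imports Defs "HOL-Library.Multiset"
begin

text \<open>
  The proof is by induction on the number of layers \<open>{i. \<delta> i = t}\<close>, from the deepest one upwards.
  Suppose that products of two normal words in the deep generators (those beyond the current
  layer) are collected in at most \<open>F\<close> steps through words of length at most \<open>L\<close>. Let \<open>n1\<close> and \<open>n2\<close> be the
  maximal lengths of normal words in the current layer and in the deep generators.

  Collection from the left inserts the letters of the second factor one by one into a normal
  word \<open>a @ q\<close>, where \<open>a\<close> lies in the current layer and \<open>q\<close> is deep. A letter \<open>x\<close> of the layer first
  travels left past \<open>q\<close> and past the letters of \<open>a\<close> that exceed \<open>x\<close>. Each deep letter passed becomes a deep
  normal word; each letter \<open>y\<close> of the layer becomes at most a \<open>y\<close> followed by a deep normal word.
  Because these letters \<open>y\<close> appear in increasing order, reinserting them involves no further exchange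
  inside the layer: each \<open>y\<close> only passes the deep word collected so far, and then at most
  one power relation is applied at the end of \<open>a\<close>. Apart from these moves, only products of
  deep normal words are collected. This is \<open>insert_letter\<close>.

  The number of exchanges inside the layer is that of an abelian group: a letter \<open>x\<close> meets at most
  as many larger letters as fit into a normal word, and summing this over a normal word
  gives \<open>E\<close> with \<open>2 * E + n1 \<le> n1\<^sup>2\<close> (\<open>crossings_le\<close>). Each power step shortens the part of the word in
  the layer, which bounds their number by \<open>2 * n1 - 1\<close>. Altogether (\<open>pairs_collect_layer\<close>) the steps are
  about \<open>n1 * n2 + E * n2\<close> plus as many collections of deep pairs, which is at most \<open>F * (n1 + n2)\<^sup>3\<close>, and
  the word length is at most \<open>2 * n1 + n1 * n2 + 2 * n2\<^sup>2 + L\<close>. With a single layer, \<open>E\<close> and the power steps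
  alone give at most \<open>n1\<^sup>2\<close> steps. So every further layer raises the exponent of \<open>N\<close> in the number of steps by 3
  and adds at most \<open>2 * N\<^sup>2\<close> to the length bound (\<open>layer_length_arith\<close>; from one layer to two, the term
  \<open>2 * n2\<close> is absorbed as well).
\<close>

section \<open>Normal words and left-most redexes\<close>

locale pc =
  fixes m :: nat and e :: "nat \<Rightarrow> nat" and v :: "nat \<Rightarrow> nat \<Rightarrow> word"
  assumes e_gt_1: "i \<in> {1..m} \<Longrightarrow> 1 < e i"
    and v_above: "1 \<le> i \<Longrightarrow> i \<le> j \<Longrightarrow> j \<le> m \<Longrightarrow> set (v i j) \<subseteq> {i + 1..m}"
begin

text \<open>
  Normal words with letters in an interval; this form, by order and multiplicities,
  passes to subwords and to concatenations over adjacent intervals.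
\<close>

definition normal_in :: "nat \<Rightarrow> nat \<Rightarrow> word \<Rightarrow> bool" where
  "normal_in k l w \<longleftrightarrow> set w \<subseteq> {k..<l} \<and> sorted w \<and> (\<forall>i. count_list w i \<le> e i - 1)"

text \<open>The maximal length of a normal word with letters in \<open>{k..<l}\<close>.\<close>

definition size_in :: "nat \<Rightarrow> nat \<Rightarrow> nat" where
  "size_in k l = (\<Sum>i = k..<l. e i - 1)"

lemma normal_inD:
  assumes "normal_in k l w"
  shows "set w \<subseteq> {k..<l}" "sorted w" "count_list w i \<le> e i - 1"
  using assms by (auto simp: normal_in_def)

lemma normal_in_Nil [simp]: "normal_in k l []"
  by (simp add: normal_in_def)

lemma normal_in_weaken: "normal_in k l w \<Longrightarrow> k' \<le> k \<Longrightarrow> l \<le> l' \<Longrightarrow> normal_in k' l' w"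
  by (fastforce simp: normal_in_def)

lemma normal_in_appendD:
  assumes "normal_in k l (x @ y)"
  shows "normal_in k l x" "normal_in k l y"
  using assms unfolding normal_in_def
  by (auto simp: sorted_append intro: add_leD1 add_leD2)

lemma normal_in_append:
  assumes "normal_in k c x" "normal_in c l y" "k \<le> c" "c \<le> l"
  shows "normal_in k l (x @ y)"
proof -
  have "count_list (x @ y) i \<le> e i - 1" for i
  proof (cases "i < c")
    case True
    then have "count_list y i = 0"
      using normal_inD(1)[OF assms(2)] by (auto simp: count_list_0_iff)
    then show ?thesis using normal_inD(3)[OF assms(1), of i] by simp
  next
    case False
    then have "count_list x i = 0"
      using normal_inD(1)[OF assms(1)] by (auto simp: count_list_0_iff)
    then show ?thesis using normal_inD(3)[OF assms(2), of i] by simp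
  qed
  moreover have "sorted (x @ y)"
    using normal_inD[OF assms(1)] normal_inD[OF assms(2)] unfolding sorted_append by fastforce
  moreover have "set (x @ y) \<subseteq> {k..<l}"
    using normal_inD(1)[OF assms(1)] normal_inD(1)[OF assms(2)] assms(3,4) by fastforce
  ultimately show ?thesis unfolding normal_in_def by blast
qed

lemma length_eq_sum_count:
  fixes w :: word
  assumes "set w \<subseteq> {k..<l}"
  shows "length w = (\<Sum>i = k..<l. count_list w i)"
proof -
  have "length w = (\<Sum>i \<in> set w. count_list w i)"
    by (simp add: sum_count_set)
  also have "\<dots> = (\<Sum>i = k..<l. count_list w i)"
    by (rule sum.mono_neutral_left) (use assms in \<open>auto simp: count_list_0_iff\<close>)
  finally show ?thesis .
qed

lemma length_normal_in: "normal_in k l w \<Longrightarrow> length w \<le> size_in k l"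
  unfolding size_in_def
  using length_eq_sum_count[of w k l] sum_mono[of "{k..<l}" "count_list w" "\<lambda>i. e i - 1"]
  by (simp add: normal_in_def)

lemma size_in_split: "k \<le> c \<Longrightarrow> c \<le> l \<Longrightarrow> size_in k l = size_in k c + size_in c l"
  unfolding size_in_def by (simp add: sum.atLeastLessThan_concat)

lemma normal_in_split:
  assumes "normal_in k l w"
  obtains x y where "w = x @ y" "normal_in k c x" "normal_in c l y"
proof -
  let ?x = "filter (\<lambda>z. z < c) w" and ?y = "filter (\<lambda>z. \<not> z < c) w"
  have w: "w = ?x @ ?y" using normal_inD(2)[OF assms]
  proof (induction w)
    case (Cons z w)
    show ?case
    proof (cases "z < c")
      case False
      then have "filter (\<lambda>z. z < c) w = []" using Cons.prems by (fastforce simp: filter_empty_conv)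
      then show ?thesis using Cons False by simp
    qed (use Cons in simp)
  qed simp
  have "normal_in k l ?x" "normal_in k l ?y" using assms w normal_in_appendD by metis+
  then have "normal_in k c ?x" "normal_in c l ?y" unfolding normal_in_def by auto
  with w that show thesis by blast
qed

lemma size_in_Suc: "k < l \<Longrightarrow> size_in k l = e k - 1 + size_in (Suc k) l"
  unfolding size_in_def by (rule sum.atLeast_Suc_lessThan)

text \<open>
  With \<open>h i = e i - 1\<close> this says that the sum of \<open>h i * h j\<close> over \<open>i < j\<close> is at most half of
  \<open>n\<^sup>2 - n\<close>, where \<open>n\<close> is the sum of all \<open>h i\<close>: expand \<open>n\<^sup>2\<close> and use \<open>h i \<le> h i\<^sup>2\<close>.
\<close>

lemma sum_size_above:
  "k \<le> l \<Longrightarrow> 2 * (\<Sum>i = k..<l. (e i - 1) * size_in (Suc i) l) + size_in k l \<le> size_in k l * size_in k l"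
proof (induction k rule: inc_induct)
  case base
  then show ?case by (simp add: size_in_def)
next
  case (step k)
  define h where "h = e k - 1"
  define S where "S = size_in (Suc k) l"
  define X where "X = (\<Sum>i = Suc k..<l. (e i - 1) * size_in (Suc i) l)"
  have "2 * X + S \<le> S * S" using step unfolding S_def X_def by simp
  moreover have "h \<le> h * h" by simp
  ultimately have "2 * X + S + h \<le> S * S + h * h" by (rule add_mono)
  then have "2 * (h * S + X) + (h + S) \<le> (h + S) * (h + S)" by (simp add: algebra_simps)
  moreover have "(\<Sum>i = k..<l. (e i - 1) * size_in (Suc i) l) = h * S + X"
    unfolding h_def S_def X_def using step.hyps(2) by (rule sum.atLeast_Suc_lessThan)
  ultimately show ?case unfolding size_in_Suc[OF step.hyps(2)] h_def S_def by simp
qed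

lemma crossings_le:
  assumes "normal_in k l xs" "k \<le> l"
  shows "2 * (\<Sum>x\<leftarrow>xs. size_in (Suc x) l) + size_in k l \<le> size_in k l * size_in k l"
proof -
  have "(\<Sum>x\<leftarrow>xs. size_in (Suc x) l) = (\<Sum>i = k..<l. count_list xs i * size_in (Suc i) l)"
    using normal_inD(1)[OF assms(1)] by (intro sum_list_map_eq_sum_count2) auto
  also have "\<dots> \<le> (\<Sum>i = k..<l. (e i - 1) * size_in (Suc i) l)"
    using normal_inD(3)[OF assms(1)] by (intro sum_mono mult_le_mono1)
  finally show ?thesis using sum_size_above[OF assms(2)] by linarith
qed

lemma normal_words_eq: "w \<in> normal_words m e \<longleftrightarrow> normal_in 1 (Suc m) w"
proof -
  let ?c = "\<lambda>\<alpha> k l. concat (map (\<lambda>i. replicate (\<alpha> i) i) [k..<l])"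
  have props: "set (?c \<alpha> k l) \<subseteq> {k..<l} \<and> sorted (?c \<alpha> k l) \<and>
      (\<forall>i. count_list (?c \<alpha> k l) i = (if i \<in> {k..<l} then \<alpha> i else 0))" for \<alpha> :: "nat \<Rightarrow> nat" and k l
  proof (induction l)
    case 0
    then show ?case by simp
  next
    case (Suc l)
    have rep: "count_list (replicate n x) y = (if x = y then n else 0)" for n and x y :: nat
      by (induction n) auto
    show ?case
    proof (cases "k \<le> l")
      case True
      then have "?c \<alpha> k (Suc l) = ?c \<alpha> k l @ replicate (\<alpha> l) l" by simp
      then show ?thesis using Suc True by (fastforce simp: sorted_append rep simp del: upt_Suc)
    qed simp
  qed
  show ?thesis
  proof
    assume "w \<in> normal_words m e"
    then obtain \<alpha> where w: "w = ?c \<alpha> 1 (Suc m)" and \<alpha>: "\<forall>i\<in>{1..m}. \<alpha> i < e i"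
      unfolding normal_words_def by blast
    have "count_list w i \<le> e i - 1" for i
    proof (cases "i \<in> {1..m}")
      case True
      then have "count_list w i = \<alpha> i" "\<alpha> i < e i" using props[of \<alpha> 1 "Suc m"] \<alpha> w by auto
      then show ?thesis by linarith
    next
      case False
      then have "i \<notin> {1..<Suc m}" by auto
      then have "count_list w i = 0" using props[of \<alpha> 1 "Suc m"] w by presburger
      then show ?thesis by linarith
    qed
    then show "normal_in 1 (Suc m) w"
      unfolding normal_in_def using props[of \<alpha> 1 "Suc m"] w by blast
  next
    assume w: "normal_in 1 (Suc m) w"
    let ?w = "?c (count_list w) 1 (Suc m)"
    have "mset w = mset ?w"
    proof (rule multiset_eqI)
      fix i
      have "count_list w i = count_list ?w i"
        using props[of "count_list w" 1 "Suc m"] normal_inD(1)[OF w]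
        by (auto simp: count_list_0_iff)
      then show "count (mset w) i = count (mset ?w) i"
        by (simp only: count_mset)
    qed
    then have "w = ?w"
      using props[of "count_list w" 1 "Suc m"] normal_inD(2)[OF w]
      by (metis properties_for_sort)
    moreover have "count_list w i < e i" if "i \<in> {1..m}" for i
      using normal_inD(3)[OF w, of i] e_gt_1[OF that] by linarith
    ultimately show "w \<in> normal_words m e" unfolding normal_words_def by blast
  qed
qed

text \<open>
  A redex is left-most exactly if everything before its last letter is normal. In this form
  left-most steps are visibly preserved when a smaller normal prefix and any suffix are added.
\<close>

definition lstep :: "word \<Rightarrow> word \<Rightarrow> bool" where
  "lstep x y \<longleftrightarrow> (\<exists>p l r s. (l, r) \<in> pc_relations m e v \<and> x = p @ l @ s \<and> y = p @ r @ s \<and>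
     normal_in 1 (Suc m) (p @ butlast l))"

lemma redex_not_normal:
  assumes "(l, r) \<in> pc_relations m e v"
  shows "\<not> normal_in k n (x @ l @ y)"
proof
  assume "normal_in k n (x @ l @ y)"
  then have n: "normal_in k n l" using normal_in_appendD by blast
  have rep: "count_list (replicate n x) x = n" for n and x :: nat
    by (induction n) auto
  from assms consider i where "i \<in> {1..m}" "l = replicate (e i) i"
    | i j where "i < j" "l = [j, i]" unfolding pc_relations_def by auto
  then show False
  proof cases
    case 1
    then show ?thesis using normal_inD(3)[OF n, of i] e_gt_1[of i] rep by simp
  next
    case 2
    then show ?thesis using normal_inD(2)[OF n] by simp
  qed
qed

lemma redex_not_inside:
  assumes "(l, r) \<in> pc_relations m e v" "(l', r') \<in> pc_relations m e v"
    and "l' = x @ l @ y"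
  shows "x = [] \<and> y = []"
proof -
  have cases: "(\<exists>i \<in> {1..m}. l = replicate (e i) i) \<or> (\<exists>i j. i < j \<and> l = [j, i])"
    if "(l, r) \<in> pc_relations m e v" for l r
    using that unfolding pc_relations_def by auto
  have "2 \<le> length l" using cases[OF assms(1)] e_gt_1 by fastforce
  show ?thesis
  proof (cases "\<exists>i \<in> {1..m}. l' = replicate (e i) i")
    case True
    then obtain i where i: "l' = replicate (e i) i" by blast
    then have "set (x @ l @ y) \<subseteq> {i}" using assms(3) by (metis set_replicate_conv_if empty_subsetI order_refl)
    then have *: "set l \<subseteq> {i}" by auto
    from cases[OF assms(1)] have "l = replicate (e i) i"
    proof
      assume "\<exists>k\<in>{1..m}. l = replicate (e k) k"
      then obtain k where "k \<in> {1..m}" "l = replicate (e k) k" by blast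
      with * e_gt_1[of k] show ?thesis by (cases "e k") auto
    qed (use * in auto)
    then have "length (x @ l @ y) = length l" using i assms(3) by metis
    then show ?thesis by simp
  next
    case False
    then have "length l' = 2" using cases[OF assms(2)] by auto
    then have "length x + length y = 0" using \<open>2 \<le> length l\<close> assms(3) by (simp del: length_0_conv)
    then show ?thesis by simp
  qed
qed

text \<open>
  A redex that starts further left either ends within the normal part \<open>p @ butlast l\<close>, or properly
  contains \<open>l\<close>; neither is possible.
\<close>

lemma lstep_left_collection_step:
  assumes "lstep x y"
  shows "left_collection_step m e v x y"
proof -
  obtain p l r s where step: "(l, r) \<in> pc_relations m e v" "x = p @ l @ s" "y = p @ r @ s"
    and n: "normal_in 1 (Suc m) (p @ butlast l)"
    using assms unfolding lstep_def by blast
  have "length p \<le> length p'"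
    if step': "(l', r') \<in> pc_relations m e v" "x = p' @ l' @ s'" for p' l' r' s'
  proof (rule ccontr)
    assume "\<not> length p \<le> length p'"
    then obtain d where d: "p = p' @ d" "d \<noteq> []"
      using step(2) step'(2) by (auto simp: append_eq_append_conv_if dest: sym)
        (metis append_take_drop_id drop_eq_Nil)
    have eq: "d @ l @ s = l' @ s'" using step(2) step'(2) d by simp
    have "l \<noteq> []" using redex_not_normal[OF step(1), of 1 1 "[]" "[]"] by auto
    then obtain b z where l: "l = b @ [z]" by (metis rev_exhaust)
    consider t where "l' = d @ l @ t" | t where "d @ b = l' @ t"
    proof -
      from eq have "(\<exists>t. l' = (d @ l) @ t) \<or> (\<exists>t. d @ l = l' @ t)"
        by (metis append.assoc append_eq_append_conv2)
      moreover have "(\<exists>t. d @ b = l' @ t) \<or> l' = d @ l" if "d @ l = l' @ t" for t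
        using that by (cases t rule: rev_cases) (auto simp: l)
      ultimately show thesis using that by (metis append.assoc append_Nil2)
    qed
    then show False
    proof cases
      case 1
      then show ?thesis using redex_not_inside[OF step(1) step'(1)] d by blast
    next
      case 2
      then have "p @ butlast l = p' @ l' @ t" using d l by simp
      then show ?thesis using n redex_not_normal[OF step'(1)] by metis
    qed
  qed
  with step show ?thesis unfolding left_collection_step_def by blast
qed

lemma lstep_set:
  assumes "lstep x y" "set x \<subseteq> {k..<Suc m}"
  shows "set y \<subseteq> {k..<Suc m}"
proof -
  obtain p l r s where s: "(l, r) \<in> pc_relations m e v" "x = p @ l @ s" "y = p @ r @ s"
    using assms(1) unfolding lstep_def by blast
  have "\<exists>i j. i \<in> set l \<and> set r \<subseteq> insert i {i + 1..m}"
    using s(1) unfolding pc_relations_def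
  proof (elim UnE, goal_cases)
    case 1
    then obtain i where i: "1 \<le> i" "i \<le> m" "l = replicate (e i) i" "r = v i i" by auto
    then show ?case using v_above[of i i] e_gt_1[of i] by (intro exI[of _ i]) auto
  next
    case 2
    then obtain i j where "1 \<le> i" "i < j" "j \<le> m" "l = [j, i]" "r = i # v i j" by auto
    then show ?case using v_above[of i j] by (intro exI[of _ i]) auto
  qed
  then show ?thesis using s(2,3) assms(2) by fastforce
qed

text \<open>
  At most \<open>n\<close> left-most steps lead from \<open>x\<close> to \<open>y\<close>, through words of length at most \<open>L\<close>. Both numbers
  are only upper bounds, so that estimates can be weakened freely.
\<close>

inductive collects :: "nat \<Rightarrow> nat \<Rightarrow> word \<Rightarrow> word \<Rightarrow> bool" for L where
  refl: "length x \<le> L \<Longrightarrow> collects L n x x"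
| step: "length x \<le> L \<Longrightarrow> lstep x y \<Longrightarrow> collects L n y z \<Longrightarrow> collects L (Suc n) x z"

lemma collects_one: "lstep x y \<Longrightarrow> length x \<le> L \<Longrightarrow> length y \<le> L \<Longrightarrow> collects L 1 x y"
  using collects.step[OF _ _ collects.refl, of x L y 0] by simp

lemma collects_mono: "collects L n x y \<Longrightarrow> L \<le> L' \<Longrightarrow> n \<le> n' \<Longrightarrow> collects L' n' x y"
proof (induction arbitrary: n' rule: collects.induct)
  case (refl x n)
  then show ?case by (auto intro: collects.refl)
next
  case (step x y n z)
  then obtain k where "n' = Suc k" "n \<le> k" by (metis Suc_le_D Suc_le_mono)
  then show ?case using step by (auto intro: collects.step)
qed

lemma collects_trans: "collects L n x y \<Longrightarrow> collects L n' y z \<Longrightarrow> collects L (n + n') x z"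
proof (induction rule: collects.induct)
  case (refl x n)
  then show ?case by (auto intro: collects_mono)
next
  case (step x y n z)
  then show ?case by (auto intro: collects.step)
qed

lemma lstep_context:
  assumes "lstep x y" "normal_in 1 c a" "set x \<subseteq> {c..<Suc m}" "1 \<le> c" "c \<le> Suc m"
  shows "lstep (a @ x @ s) (a @ y @ s)"
proof -
  obtain p l r t where s: "(l, r) \<in> pc_relations m e v" "x = p @ l @ t" "y = p @ r @ t"
      "normal_in 1 (Suc m) (p @ butlast l)"
    using assms(1) unfolding lstep_def by blast
  have "normal_in c (Suc m) (p @ butlast l)"
    using s(2,4) assms(3) unfolding normal_in_def by (auto dest: in_set_butlastD)
  from normal_in_append[OF assms(2) this assms(4,5)]
  show ?thesis unfolding lstep_def
    using s by (intro exI[of _ "a @ p"] exI[of _ l] exI[of _ r] exI[of _ "t @ s"]) simp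
qed

lemma collects_context:
  assumes "collects L n x y" "normal_in 1 c a" "set x \<subseteq> {c..<Suc m}" "1 \<le> c" "c \<le> Suc m"
    and "length a + L + length s \<le> L'"
  shows "collects L' n (a @ x @ s) (a @ y @ s)"
  using assms(1,3)
proof (induction rule: collects.induct)
  case (refl x n)
  then show ?case using assms by (auto intro: collects.refl)
next
  case (step x y n z)
  have "collects L' n (a @ y @ s) (a @ z @ s)"
    using step.IH lstep_set[OF step.hyps(2) step.prems] by blast
  then show ?case using lstep_context[OF step.hyps(2) assms(2) step.prems assms(4,5)] step.hyps(1) assms(6)
    by (intro collects.step) auto
qed

lemma collects_sequence:
  assumes "collects L n x y"
  shows "\<exists>k W. k \<le> n \<and> W 0 = x \<and> W k = y \<and> (\<forall>i<k. left_collection_step m e v (W i) (W (Suc i))) \<and>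
    (\<forall>i\<le>k. length (W i) \<le> L)"
  using assms
proof (induction rule: collects.induct)
  case (refl x n)
  then show ?case by (intro exI[of _ 0] exI[of _ "\<lambda>_. x"]) simp
next
  case (step x y n z)
  then obtain k W where W: "k \<le> n" "W 0 = y" "W k = z"
    "\<forall>i<k. left_collection_step m e v (W i) (W (Suc i))" "\<forall>i\<le>k. length (W i) \<le> L" by blast
  have "left_collection_step m e v x y" using step.hyps(2) lstep_left_collection_step by blast
  with W step.hyps(1) show ?case
    by (intro exI[of _ "Suc k"] exI[of _ "case_nat x W"]) (auto split: nat.split)
qed

text \<open>
  The moving letter stays left-most: everything before it is normal, and the words
  that it leaves behind are not touched until it has come to rest.
\<close>

lemma collects_pass:
  assumes "normal_in 1 (Suc m) (a @ ys)" "1 \<le> x" "\<forall>y \<in> set ys. x < y"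
    and "length a + 1 + (\<Sum>y\<leftarrow>ys. max 1 (length (v x y))) + length s \<le> L"
  shows "collects L (length ys) (a @ ys @ x # s) (a @ x # concat (map (v x) ys) @ s)"
  using assms
proof (induction ys arbitrary: s rule: rev_induct)
  case Nil
  then show ?case by (auto intro: collects.refl)
next
  case (snoc y ys)
  have len: "length ys \<le> (\<Sum>y\<leftarrow>ys. max 1 (length (v x y)))"
    by (induction ys) auto
  have y: "y \<le> m" "x < y" using snoc.prems(1,3) unfolding normal_in_def by auto
  have "([y, x], x # v x y) \<in> pc_relations m e v"
    using y snoc.prems(2) unfolding pc_relations_def by blast
  then have "lstep (a @ (ys @ [y]) @ x # s) (a @ ys @ x # v x y @ s)"
    unfolding lstep_def using snoc.prems(1)
    by (intro exI[of _ "a @ ys"] exI[of _ "[y, x]"] exI[of _ "x # v x y"] exI[of _ s]) simp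
  moreover have "collects L (length ys) (a @ ys @ x # v x y @ s) (a @ x # concat (map (v x) ys) @ v x y @ s)"
    using snoc.prems normal_in_appendD(1)[of 1 "Suc m" "a @ ys" "[y]"]
    by (intro snoc.IH) auto
  ultimately show ?case using snoc.prems(4) len
    by (auto intro!: collects.step)
qed

definition pairs_collect :: "nat \<Rightarrow> nat \<Rightarrow> nat \<Rightarrow> bool" where
  "pairs_collect c F L \<longleftrightarrow> (\<forall>u w. normal_in c (Suc m) u \<longrightarrow> normal_in c (Suc m) w \<longrightarrow>
     (\<exists>z. normal_in c (Suc m) z \<and> collects L F (u @ w) z))"

end


section \<open>Collection in one layer\<close>

text \<open>
  The letters in \<open>{b..<c}\<close> form the current layer, and those in \<open>{c..m}\<close> are the deeper ones, for which
  bounds \<open>F\<close> and \<open>L\<close> are already known. For the deepest layer, \<open>c = Suc m\<close> and \<open>F = L = 0\<close>.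
\<close>

locale layer = pc +
  fixes b c F L :: nat
  assumes bounds: "1 \<le> b" "b < c" "c \<le> Suc m"
    and power: "i \<in> {b..<c} \<Longrightarrow> Suc i < c \<and> v i i = [Suc i] \<or> normal_in c (Suc m) (v i i)"
    and conjugate: "i \<in> {b..<c} \<Longrightarrow> j \<in> {i<..<c} \<Longrightarrow>
      \<exists>w. normal_in c (Suc m) w \<and> (v i j = w \<or> v i j = j # w)"
    and conjugate_deep: "i \<in> {b..<c} \<Longrightarrow> j \<in> {c..<Suc m} \<Longrightarrow> normal_in c (Suc m) (v i j)"
    and pairs: "pairs_collect c F L"
    and L_ge: "2 * size_in c (Suc m) \<le> L"
begin

abbreviation "shallow \<equiv> normal_in b c"
abbreviation "deep \<equiv> normal_in c (Suc m)"
abbreviation "n1 \<equiv> size_in b c"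
abbreviation "n2 \<equiv> size_in c (Suc m)"

lemma deep_length: "deep w \<Longrightarrow> length w \<le> n2"
  by (rule length_normal_in)

lemma shallow_length: "shallow w \<Longrightarrow> length w \<le> n1"
  by (rule length_normal_in)

lemma shallow_normal: "shallow a \<Longrightarrow> normal_in 1 c a"
  using bounds normal_in_weaken by blast

lemma shallow_deep_normal: "shallow a \<Longrightarrow> deep q \<Longrightarrow> normal_in 1 (Suc m) (a @ q)"
  using bounds by (intro normal_in_append[of 1 c] shallow_normal) auto

lemma length_concat_deep: "\<forall>w \<in> set ws. deep w \<Longrightarrow> length (concat ws) \<le> length ws * n2"
proof (induction ws)
  case (Cons w ws)
  then show ?case using deep_length[of w] by simp
qed simp

lemma collect_deep_words:
  assumes "shallow a" "deep q" "\<forall>w \<in> set ws. deep w"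
    and "length a + L + length ws * n2 + length s \<le> B"
  shows "\<exists>q'. deep q' \<and> collects B (length ws * F) (a @ q @ concat ws @ s) (a @ q' @ s)"
  using assms(2-)
proof (induction ws arbitrary: q)
  case Nil
  have "length (a @ q @ s) \<le> B" using Nil deep_length[of q] L_ge by simp
  then show ?case using Nil by (intro exI[of _ q]) (auto intro: collects.refl)
next
  case (Cons w ws)
  have w: "deep w" using Cons.prems by simp
  obtain z where z: "deep z" "collects L F (q @ w) z"
    using pairs Cons.prems(1) w unfolding pairs_collect_def by blast
  have "length a + L + length (concat ws @ s) \<le> B"
    using Cons.prems(2,3) length_concat_deep[of ws] by simp
  moreover have "set (q @ w) \<subseteq> {c..<Suc m}"
    using normal_inD(1)[OF Cons.prems(1)] normal_inD(1)[OF w] by simp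
  ultimately have "collects B F (a @ (q @ w) @ concat ws @ s) (a @ z @ concat ws @ s)"
    using bounds by (intro collects_context[OF z(2) shallow_normal[OF assms(1)]]) auto
  moreover obtain q' where "deep q'" "collects B (length ws * F) (a @ z @ concat ws @ s) (a @ q' @ s)"
    using Cons.IH[OF z(1)] Cons.prems(2,3) by auto
  ultimately show ?case using collects_trans by fastforce
qed

text \<open>
  A sorted word of the layer that has at most one letter more than a normal word. While a letter
  is being inserted, the normal part together with the letters waiting to be reinserted has
  this shape; the excess letter is where the next power relation can occur.
\<close>

definition one_excess :: "word \<Rightarrow> bool" where
  "one_excess w \<longleftrightarrow> set w \<subseteq> {b..<c} \<and> sorted w \<and>
     (\<exists>z. \<forall>i. count_list w i \<le> e i - 1 + (if i = z then 1 else 0))"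

lemma one_excess_length:
  assumes "one_excess w"
  shows "length w \<le> n1 + 1"
proof -
  obtain z where z: "\<And>i. count_list w i \<le> e i - 1 + (if i = z then 1 else 0)"
    using assms unfolding one_excess_def by blast
  have "length w = (\<Sum>i = b..<c. count_list w i)"
    using assms length_eq_sum_count unfolding one_excess_def by blast
  also have "\<dots> \<le> (\<Sum>i = b..<c. e i - 1 + (if i = z then 1 else 0))"
    by (intro sum_mono z)
  also have "\<dots> \<le> n1 + 1" unfolding size_in_def sum.distrib by (simp add: sum.delta)
  finally show ?thesis .
qed

text \<open>
  If \<open>a @ [y]\<close> is not normal, then \<open>y\<close> is the excess letter and does not occur in \<open>gs\<close>. The power relation
  then moves the excess to \<open>Suc y\<close>, which is still below or among the waiting letters \<open>gs\<close>, or removes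
  it. Each power step is paid for by the shortening of \<open>a @ gs\<close>. Taking the maximum with 1 accounts for
  a last power step that leaves nothing in the layer: it removes at least two letters.
  The step saved in this way matters in \<open>abelian_steps_arith\<close>.
\<close>

lemma append_letter:
  assumes a: "shallow a" and ex: "one_excess (a @ y # gs)"
  shows "\<exists>a' q P. shallow a' \<and> deep q \<and> one_excess (a' @ gs) \<and>
    max 1 (length (a' @ gs)) + P \<le> max 1 (length (a @ y # gs)) \<and>
    length (a' @ q) \<le> length a + 1 + n2 \<and>
    (\<forall>s B. length a + 1 + n2 + length s \<le> B \<longrightarrow> collects B P (a @ y # s) (a' @ q @ s))"
proof (cases "count_list a y < e y - 1")
  case True
  have "count_list (a @ [y]) i \<le> e i - 1" for i
    using normal_inD(3)[OF a, of i] True by auto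
  moreover have "set (a @ [y]) \<subseteq> {b..<c}" "sorted (a @ [y])"
    using ex unfolding one_excess_def by (auto simp: sorted_append)
  ultimately have "shallow (a @ [y])" unfolding normal_in_def by blast
  with ex show ?thesis
    by (intro exI[of _ "a @ [y]"] exI[of _ "[]"] exI[of _ 0]) (auto intro!: collects.refl)
next
  case False
  then have cnt: "count_list a y = e y - 1" using normal_inD(3)[OF a, of y] by linarith
  have y: "y \<in> {b..<c}" and ym: "y \<in> {1..m}" and le: "\<forall>z \<in> set a. z \<le> y" and ge: "\<forall>z \<in> set gs. y \<le> z"
    and srt: "sorted a" "sorted gs" and sub: "set a \<subseteq> {b..<c}" "set gs \<subseteq> {b..<c}"
    using ex bounds unfolding one_excess_def by (auto simp: sorted_append)
  obtain z where z: "\<And>i. count_list (a @ y # gs) i \<le> e i - 1 + (if i = z then 1 else 0)"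
    using ex unfolding one_excess_def by blast
  have zy: "z = y" "count_list gs y = 0" using z[of y] cnt by (auto split: if_splits)
  then have gt: "\<forall>z \<in> set gs. y < z" using ge by (metis count_list_0_iff le_neq_implies_less)
  define a0 where "a0 = filter (\<lambda>z. z < y) a"
  \<comment> \<open>\<open>a\<close> is sorted, has no letter above \<open>y\<close>, and contains \<open>y\<close> as often as a normal word can.\<close>
  have a_eq: "a = a0 @ replicate (e y - 1) y"
    unfolding a0_def cnt[symmetric] using srt(1) le
  proof (induction a)
    case (Cons x a)
    show ?case
    proof (cases "x = y")
      case True
      with Cons.prems have "\<forall>z \<in> set a. z = y" by (auto intro: antisym)
      then have "filter (\<lambda>z. z < y) a = []" by (auto simp: filter_empty_conv)
      then show ?thesis using Cons True by simp
    qed (use Cons in auto)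
  qed simp
  have a0: "shallow a0" using a unfolding a_eq by (rule normal_in_appendD)
  have a0_less: "\<forall>z \<in> set a0. z < y" by (simp add: a0_def)
  have ey: "1 < e y" using e_gt_1 ym by blast
  have rep: "replicate (e y) y = replicate (e y - 1) y @ [y]"
    using ey by (metis replicate_append_same Suc_diff_1 replicate_Suc less_trans zero_less_one)
  have "(replicate (e y) y, v y y) \<in> pc_relations m e v"
    using ym unfolding pc_relations_def by auto
  then have st: "lstep (a @ y # s) (a0 @ v y y @ s)" for s
    unfolding lstep_def using shallow_deep_normal[OF a, of "[]"]
    by (intro exI[of _ a0] exI[of _ "replicate (e y) y"] exI[of _ "v y y"] exI[of _ s])
      (simp add: rep a_eq)
  have len_a: "length a = length a0 + (e y - 1)" by (simp add: a_eq)
  have cnt0: "count_list (a0 @ gs) i \<le> e i - 1" for i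
    using z[of i] zy by (cases "i = y") (auto simp: a_eq count_list_0_iff dest: a0_less[rule_format])
  consider "Suc y < c" "v y y = [Suc y]" | "deep (v y y)" using power[OF y] by blast
  then show ?thesis
  proof cases
    case 1
    have "Suc y \<notin> set a0" using a0_less by auto
    moreover have "1 < e (Suc y)" using e_gt_1[of "Suc y"] 1(1) bounds by auto
    ultimately have "shallow (a0 @ [Suc y])"
      using a0 a0_less 1(1) y unfolding normal_in_def
      by (auto simp: sorted_append count_list_0_iff less_imp_le le_SucI)
    moreover have "one_excess ((a0 @ [Suc y]) @ gs)"
      unfolding one_excess_def
    proof (intro conjI exI[of _ "Suc y"] allI)
      show "sorted ((a0 @ [Suc y]) @ gs)"
        using srt a0_less gt normal_inD(2)[OF a0] by (fastforce simp: sorted_append)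
      show "count_list ((a0 @ [Suc y]) @ gs) i \<le> e i - 1 + (if i = Suc y then 1 else 0)" for i
        using cnt0[of i] by auto
      show "set ((a0 @ [Suc y]) @ gs) \<subseteq> {b..<c}"
        using normal_inD(1)[OF a0] sub 1(1) y by auto
    qed
    ultimately show ?thesis using st 1(2) len_a ey
      by (intro exI[of _ "a0 @ [Suc y]"] exI[of _ "[]"] exI[of _ 1]) (auto intro!: collects_one[simplified])
  next
    case 2
    have "one_excess (a0 @ gs)"
      unfolding one_excess_def
    proof (intro conjI exI[of _ 0] allI)
      show "sorted (a0 @ gs)"
        using srt a0_less gt normal_inD(2)[OF a0] by (fastforce simp: sorted_append)
      show "count_list (a0 @ gs) i \<le> e i - 1 + (if i = 0 then 1 else 0)" for i
        using cnt0[of i] by auto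
      show "set (a0 @ gs) \<subseteq> {b..<c}"
        using normal_inD(1)[OF a0] sub by auto
    qed
    then show ?thesis using st 2 len_a ey a0 deep_length[OF 2]
      by (intro exI[of _ a0] exI[of _ "v y y"] exI[of _ 1]) (auto intro!: collects_one[simplified])
  qed
qed

lemma pass_deep:
  assumes "shallow a" "deep q" "y \<in> {b..<c}"
    and "length a + 1 + n2 * n2 + length s \<le> B"
  shows "collects B n2 (a @ q @ y # s) (a @ y # concat (map (v y) q) @ s)"
    and "\<forall>w \<in> set (map (v y) q). deep w"
proof -
  have q: "set q \<subseteq> {c..<Suc m}" using normal_inD(1)[OF assms(2)] .
  show *: "\<forall>w \<in> set (map (v y) q). deep w"
    using q conjugate_deep[OF assms(3)] by auto
  have "(\<Sum>z\<leftarrow>q. max 1 (length (v y z))) \<le> length q * n2"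
  proof (cases "q = []")
    case False
    then have "1 \<le> n2" using deep_length[OF assms(2)] by (cases q) auto
    then have "\<forall>z \<in> set q. max 1 (length (v y z)) \<le> n2" using * deep_length by auto
    then have "(\<Sum>z\<leftarrow>q. max 1 (length (v y z))) \<le> (\<Sum>z\<leftarrow>q. n2)" by (intro sum_list_mono) auto
    then show ?thesis by (simp add: sum_list_triv)
  qed simp
  also have "\<dots> \<le> n2 * n2" using deep_length[OF assms(2)] by simp
  finally have "collects B (length q) (a @ q @ y # s) (a @ y # concat (map (v y) q) @ s)"
    using assms(3,4) bounds q
    by (intro collects_pass shallow_deep_normal[OF assms(1,2)]) auto
  then show "collects B n2 (a @ q @ y # s) (a @ y # concat (map (v y) q) @ s)"
    using deep_length[OF assms(2)] by (auto elim: collects_mono)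
qed

text \<open>
  The blocks \<open>G y @ U y\<close> are what a moving letter leaves behind when it passes the increasing letters
  \<open>ys\<close> of the layer. A waiting letter passes at most \<open>n2\<close> deep letters, which produces at most \<open>n2\<close> deep words;
  with \<open>U y\<close> there are at most \<open>n2 + 1\<close> of them to be collected.
\<close>

lemma collect_blocks:
  assumes "shallow a" "deep q" "one_excess (a @ concat (map G ys))"
    and "\<forall>y \<in> set ys. (G y = [] \<or> G y = [y]) \<and> deep (U y)"
    and "n1 + 1 + L + n2 * n2 + length ys * n2 + length s \<le> B"
  shows "\<exists>a' q' P. shallow a' \<and> deep q' \<and>
    max 1 (length a') + P \<le> max 1 (length (a @ concat (map G ys))) \<and>
    collects B (length ys * (n2 + (n2 + 1) * F) + P)
      (a @ q @ concat (map (\<lambda>y. G y @ U y) ys) @ s) (a' @ q' @ s)"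
  using assms
proof (induction ys arbitrary: a q)
  case Nil
  have "length (a @ q @ s) \<le> B"
    using Nil.prems shallow_length[of a] deep_length[of q] L_ge by simp
  then show ?case using Nil.prems
    by (intro exI[of _ a] exI[of _ q] exI[of _ 0]) (auto intro: collects.refl)
next
  case (Cons y ys)
  let ?gs = "concat (map G ys)" and ?R = "concat (map (\<lambda>y. G y @ U y) ys) @ s"
  have Uy: "deep (U y)" using Cons.prems(4) by simp
  have ih: "\<exists>a' q' P. shallow a' \<and> deep q' \<and> max 1 (length a') + P \<le> max 1 (length (a1 @ ?gs)) \<and>
      collects B (length ys * (n2 + (n2 + 1) * F) + P) (a1 @ q1 @ ?R) (a' @ q' @ s)"
    if "shallow a1" "deep q1" "one_excess (a1 @ ?gs)" for a1 q1
    using Cons.IH[OF that] Cons.prems(4,5) by simp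
  have lenR: "length ?R \<le> length ?gs + length ys * n2 + length s"
    using Cons.prems(4)
  proof (induction ys)
    case (Cons x ys)
    then show ?case using deep_length[of "U x"] by auto
  qed simp
  have len1: "length a + length (G y) + length ?gs \<le> n1 + 1"
    using one_excess_length[OF Cons.prems(3)] by simp
  have head: "\<exists>a1 q1 P. shallow a1 \<and> deep q1 \<and> one_excess (a1 @ ?gs) \<and>
      max 1 (length (a1 @ ?gs)) + P \<le> max 1 (length (a @ G y @ ?gs)) \<and>
      collects B (n2 + (n2 + 1) * F + P) (a @ q @ G y @ U y @ ?R) (a1 @ q1 @ ?R)"
  proof (cases "G y = []")
    case True
    have "length a + L + length [U y] * n2 + length ?R \<le> B"
      using lenR len1 Cons.prems(5) True by simp
    from collect_deep_words[OF Cons.prems(1,2) _ this] Uy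
    obtain q1 where "deep q1" "collects B F (a @ q @ U y @ ?R) (a @ q1 @ ?R)" by auto
    moreover have "one_excess (a @ ?gs)" using Cons.prems(3) True by simp
    ultimately show ?thesis using True Cons.prems(1)
      by (intro exI[of _ a] exI[of _ q1] exI[of _ 0]) (auto elim: collects_mono)
  next
    case False
    then have Gy: "G y = [y]" using Cons.prems(4) by auto
    have y: "y \<in> {b..<c}" using Cons.prems(3) Gy unfolding one_excess_def by simp
    have ex: "one_excess (a @ y # ?gs)" using Cons.prems(3) Gy by simp
    from append_letter[OF Cons.prems(1) ex] obtain a1 q0 P where
      1: "shallow a1" "deep q0" "one_excess (a1 @ ?gs)"
        "max 1 (length (a1 @ ?gs)) + P \<le> max 1 (length (a @ y # ?gs))"
        "length (a1 @ q0) \<le> length a + 1 + n2"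
      and 2: "\<And>s B. length a + 1 + n2 + length s \<le> B \<Longrightarrow> collects B P (a @ y # s) (a1 @ q0 @ s)"
      by blast
    let ?V = "map (v y) q"
    have "length (U y) \<le> n2" using Uy deep_length by blast
    then have "length a + 1 + n2 * n2 + length (U y @ ?R) \<le> B"
      using lenR len1 Cons.prems(5) Gy L_ge by simp
    note pass = pass_deep[OF Cons.prems(1,2) y this]
    have lenV: "length (concat ?V) \<le> n2 * n2"
      using length_concat_deep[OF pass(2)] deep_length[OF Cons.prems(2)]
      by (metis length_map mult_le_mono1 order_trans)
    have "length a + 1 + n2 + length (concat ?V @ U y @ ?R) \<le> B"
      using lenR len1 Cons.prems(5) Gy L_ge lenV \<open>length (U y) \<le> n2\<close> by simp
    note settled = 2[OF this]
    have a1: "length a1 + length ?gs \<le> n1 + 1" using one_excess_length[OF 1(3)] by simp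
    have lenVU: "length (?V @ [U y]) \<le> n2 + 1" using deep_length[OF Cons.prems(2)] by simp
    then have "length (?V @ [U y]) * n2 \<le> (n2 + 1) * n2" by (rule mult_le_mono1)
    moreover have "length a1 + L + (n2 + 1) * n2 + length ?R \<le> B"
      using lenR a1 Cons.prems(5) by simp
    ultimately have "length a1 + L + length (?V @ [U y]) * n2 + length ?R \<le> B" by linarith
    moreover have "\<forall>w \<in> set (?V @ [U y]). deep w" using pass(2) Uy by auto
    ultimately obtain q1 where "deep q1"
      and q1: "collects B (length (?V @ [U y]) * F) (a1 @ q0 @ concat (?V @ [U y]) @ ?R) (a1 @ q1 @ ?R)"
      using collect_deep_words[OF 1(1,2)] by blast
    have "length (?V @ [U y]) * F \<le> (n2 + 1) * F" using lenVU by (rule mult_le_mono1)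
    from collects_trans[OF pass(1) collects_trans[OF settled]] collects_mono[OF q1 order_refl this]
    have "collects B (n2 + (P + (n2 + 1) * F)) (a @ q @ G y @ U y @ ?R) (a1 @ q1 @ ?R)"
      by (simp add: Gy)
    then have "collects B (n2 + (n2 + 1) * F + P) (a @ q @ G y @ U y @ ?R) (a1 @ q1 @ ?R)"
      by (simp add: algebra_simps)
    then show ?thesis using 1 \<open>deep q1\<close> Gy by fastforce
  qed
  then obtain a1 q1 P1 where 1: "shallow a1" "deep q1" "one_excess (a1 @ ?gs)"
      "max 1 (length (a1 @ ?gs)) + P1 \<le> max 1 (length (a @ G y @ ?gs))"
      "collects B (n2 + (n2 + 1) * F + P1) (a @ q @ G y @ U y @ ?R) (a1 @ q1 @ ?R)" by blast
  from ih[OF 1(1-3)] obtain a' q' P2 where 2: "shallow a'" "deep q'"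
      "max 1 (length a') + P2 \<le> max 1 (length (a1 @ ?gs))"
      "collects B (length ys * (n2 + (n2 + 1) * F) + P2) (a1 @ q1 @ ?R) (a' @ q' @ s)" by blast
  have "collects B (length (y # ys) * (n2 + (n2 + 1) * F) + (P1 + P2))
      (a @ q @ concat (map (\<lambda>y. G y @ U y) (y # ys)) @ s) (a' @ q' @ s)"
    using collects_trans[OF 1(5) 2(4)] by (simp add: algebra_simps)
  moreover have "max 1 (length a') + (P1 + P2) \<le> max 1 (length (a @ concat (map G (y # ys))))"
    using 1(4) 2(3) by simp
  ultimately show ?case using 2(1,2) by blast
qed

text \<open>
  The letter \<open>x\<close> itself occupies room in a normal word, so at most \<open>n1 - 1\<close> letters
  of \<open>a\<close> exceed it; the length bound depends on this.
\<close>

lemma insert_letter: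
  assumes a: "shallow a" and q: "deep q" and x: "x \<in> {b..<c}" and s: "length s < n1 + n2"
    and B: "2 * n1 + n1 * n2 + 2 * (n2 * n2) + L \<le> B"
  shows "\<exists>a' q' P. shallow a' \<and> deep q' \<and> max 1 (length a') + P \<le> max 1 (length a) + 1 \<and>
    collects B (n2 + n2 * F + size_in (Suc x) c * (1 + n2 + (n2 + 1) * F) + P) (a @ q @ x # s) (a' @ q' @ s)"
proof -
  let ?r = "size_in (Suc x) c"
  obtain a0 ys where a_eq: "a = a0 @ ys" and a0': "normal_in b (Suc x) a0" and ys: "normal_in (Suc x) c ys"
    using normal_in_split[OF a] by blast
  have a0: "shallow a0" using a unfolding a_eq by (rule normal_in_appendD)
  have r: "length ys \<le> ?r" using ys by (rule length_normal_in)
  have "1 \<le> e x - 1" using e_gt_1[of x] x bounds by auto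
  then have "?r + 1 \<le> n1"
    using size_in_split[of b x c] size_in_Suc[of x c] x by auto
  then have r1: "length ys + 1 \<le> n1" using r by simp
  then have "(length ys + 1) * n2 \<le> n1 * n2" by (rule mult_le_mono1)
  then have r2: "length ys * n2 + n2 \<le> n1 * n2" by simp
  have len_a: "length a0 + length ys \<le> n1" using shallow_length[OF a] a_eq by simp
  have ys_gt: "y \<in> {x<..<c}" if "y \<in> set ys" for y using normal_inD(1)[OF ys] that by auto
  have "\<exists>g w. v x y = g @ w \<and> (g = [] \<or> g = [y]) \<and> deep w" if "y \<in> set ys" for y
    using conjugate[OF x ys_gt[OF that]] by (metis append_Cons append_Nil)
  then obtain G U where GU: "\<And>y. y \<in> set ys \<Longrightarrow> v x y = G y @ U y \<and> (G y = [] \<or> G y = [y]) \<and> deep (U y)"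
    by metis
  let ?gs = "concat (map G ys)" and ?V = "map (v x) q"
  have gs: "?gs = filter (\<lambda>y. G y \<noteq> []) ys"
    using GU by (induction ys) fastforce+
  have V: "\<forall>w \<in> set ?V. deep w"
    using pass_deep(2)[OF a q x order_refl] .
  have lenq: "length q \<le> n2" using q by (rule deep_length)
  have lenV: "length (concat ?V) \<le> n2 * n2"
    using length_concat_deep[OF V] lenq by (metis length_map mult_le_mono1 order_trans)
  \<comment> \<open>Four phases: \<open>x\<close> travels left, comes to rest, the blocks left by \<open>ys\<close> are
    collected, and then the deep words left by \<open>q\<close>.\<close>
  have travel: "collects B (length (ys @ q)) (a0 @ (ys @ q) @ x # s) (a0 @ x # concat (map (v x) (ys @ q)) @ s)"
  proof (rule collects_pass)
    show "normal_in 1 (Suc m) (a0 @ ys @ q)" using shallow_deep_normal[OF a q] a_eq by simp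
    show "1 \<le> x" using x bounds by simp
    show "\<forall>y \<in> set (ys @ q). x < y" using ys_gt normal_inD(1)[OF q] x by fastforce
    have "(\<Sum>y\<leftarrow>ys. max 1 (length (v x y))) \<le> (\<Sum>y\<leftarrow>ys. 1 + n2)"
      using GU deep_length by (intro sum_list_mono) fastforce
    moreover have "(\<Sum>z\<leftarrow>q. max 1 (length (v x z))) \<le> n2 * n2"
    proof (cases "q = []")
      case False
      then have "1 \<le> n2" using lenq by (cases q) auto
      then have "\<forall>z \<in> set q. max 1 (length (v x z)) \<le> n2" using V deep_length by auto
      then have "(\<Sum>z\<leftarrow>q. max 1 (length (v x z))) \<le> (\<Sum>z\<leftarrow>q. n2)" by (intro sum_list_mono) auto
      also have "\<dots> \<le> n2 * n2" using lenq by (simp add: sum_list_triv)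
      finally show ?thesis .
    qed simp
    ultimately show "length a0 + 1 + (\<Sum>y\<leftarrow>ys @ q. max 1 (length (v x y))) + length s \<le> B"
      using len_a r2 s B by (simp add: sum_list_triv)
  qed
  have step1: "collects B (?r + n2) (a @ q @ x # s) (a0 @ x # concat (map (v x) ys) @ concat ?V @ s)"
    using collects_mono[OF travel order_refl, of "?r + n2"] r lenq a_eq by simp
  have ex: "one_excess (a0 @ x # ?gs)"
    unfolding one_excess_def
  proof (intro conjI exI[of _ x] allI)
    have cnt: "count_list (filter Q zs) i \<le> count_list zs i" for Q and zs :: word and i
      by (induction zs) auto
    show "set (a0 @ x # ?gs) \<subseteq> {b..<c}"
      using normal_inD(1)[OF a0] x ys_gt unfolding gs by fastforce
    show "sorted (a0 @ x # ?gs)"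
      using normal_inD(1,2)[OF a0'] normal_inD(2)[OF ys] ys_gt unfolding gs
      by (fastforce simp: sorted_append sorted_wrt_filter)
    show "count_list (a0 @ x # ?gs) i \<le> e i - 1 + (if i = x then 1 else 0)" for i
      using normal_inD(3)[OF a, of i] cnt[of "\<lambda>y. G y \<noteq> []" ys i] unfolding gs a_eq by auto
  qed
  from append_letter[OF a0 ex] obtain a1 q1 P1 where
    1: "shallow a1" "deep q1" "one_excess (a1 @ ?gs)"
      "max 1 (length (a1 @ ?gs)) + P1 \<le> max 1 (length (a0 @ x # ?gs))"
    and step2: "\<And>s B. length a0 + 1 + n2 + length s \<le> B \<Longrightarrow> collects B P1 (a0 @ x # s) (a1 @ q1 @ s)"
    by blast
  have len_blocks: "length (concat (map (v x) ys)) \<le> length ys * (1 + n2)"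
    using GU
  proof (induction ys)
    case (Cons y ys)
    then have "length (v x y) \<le> 1 + n2" using deep_length by fastforce
    then show ?case using Cons by simp
  qed simp
  have "length a0 + 1 + n2 + length (concat (map (v x) ys) @ concat ?V @ s) \<le> B"
    using len_blocks lenV len_a r2 s B L_ge by simp
  note step2 = step2[OF this]
  have "n1 + 1 + L + n2 * n2 + length ys * n2 + length (concat ?V @ s) \<le> B"
    using lenV r2 s B by simp
  from collect_blocks[OF 1(1-3) _ this, of U] GU obtain a2 q2 P2 where
    2: "shallow a2" "deep q2" "max 1 (length a2) + P2 \<le> max 1 (length (a1 @ ?gs))"
    and step3': "collects B (length ys * (n2 + (n2 + 1) * F) + P2)
      (a1 @ q1 @ concat (map (\<lambda>y. G y @ U y) ys) @ concat ?V @ s) (a2 @ q2 @ concat ?V @ s)"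
    by blast
  have "map (\<lambda>y. G y @ U y) ys = map (v x) ys" using GU by simp
  with step3' have step3: "collects B (?r * (n2 + (n2 + 1) * F) + P2)
      (a1 @ q1 @ concat (map (v x) ys) @ concat ?V @ s) (a2 @ q2 @ concat ?V @ s)"
    using r by (auto elim!: collects_mono)
  have "length ?V * n2 \<le> n2 * n2" using lenq by simp
  moreover have "n2 \<le> n1 * n2" using r1 by simp
  ultimately have "length a2 + L + length ?V * n2 + length s \<le> B"
    using shallow_length[OF 2(1)] s B by linarith
  from collect_deep_words[OF 2(1,2) V this] obtain q3 where "deep q3"
    and step4': "collects B (length ?V * F) (a2 @ q2 @ concat ?V @ s) (a2 @ q3 @ s)" by blast
  have "length ?V * F \<le> n2 * F" using lenq by simp
  then have step4: "collects B (n2 * F) (a2 @ q2 @ concat ?V @ s) (a2 @ q3 @ s)"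
    using step4' collects_mono by blast
  have "collects B (n2 + n2 * F + ?r * (1 + n2 + (n2 + 1) * F) + (P1 + P2)) (a @ q @ x # s) (a2 @ q3 @ s)"
    using collects_trans[OF step1 collects_trans[OF step2 collects_trans[OF step3 step4]]]
    by (simp add: algebra_simps)
  moreover have "length ?gs \<le> length ys" unfolding gs by simp
  then have "max 1 (length a2) + (P1 + P2) \<le> max 1 (length a) + 1"
    using 1(4) 2(3) by (simp add: a_eq)
  ultimately show ?thesis using 2(1) \<open>deep q3\<close> by blast
qed

lemma insert_letters:
  assumes "shallow a" "deep q" "set xs \<subseteq> {b..<c}" "length xs + length s \<le> n1 + n2"
    and B: "2 * n1 + n1 * n2 + 2 * (n2 * n2) + L \<le> B"
  shows "\<exists>a' q' P. shallow a' \<and> deep q' \<and> max 1 (length a') + P \<le> max 1 (length a) + length xs \<and>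
    collects B (length xs * (n2 + n2 * F) + (\<Sum>x\<leftarrow>xs. size_in (Suc x) c) * (1 + n2 + (n2 + 1) * F) + P)
      (a @ q @ xs @ s) (a' @ q' @ s)"
  using assms(1-4)
proof (induction xs arbitrary: a q)
  case Nil
  have "length (a @ q @ s) \<le> B"
    using Nil shallow_length[of a] deep_length[of q] L_ge B by simp
  then show ?case using Nil
    by (intro exI[of _ a] exI[of _ q] exI[of _ 0]) (auto intro: collects.refl)
next
  case (Cons x xs)
  have "x \<in> {b..<c}" "length (xs @ s) < n1 + n2" using Cons.prems by auto
  from insert_letter[OF Cons.prems(1,2) this B] obtain a1 q1 P1 where
    1: "shallow a1" "deep q1" "max 1 (length a1) + P1 \<le> max 1 (length a) + 1"
      "collects B (n2 + n2 * F + size_in (Suc x) c * (1 + n2 + (n2 + 1) * F) + P1)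
        (a @ q @ x # xs @ s) (a1 @ q1 @ xs @ s)" by blast
  have "set xs \<subseteq> {b..<c}" "length xs + length s \<le> n1 + n2" using Cons.prems by auto
  from Cons.IH[OF 1(1,2) this] obtain a2 q2 P2 where
    2: "shallow a2" "deep q2" "max 1 (length a2) + P2 \<le> max 1 (length a1) + length xs"
      "collects B (length xs * (n2 + n2 * F) + (\<Sum>x\<leftarrow>xs. size_in (Suc x) c) * (1 + n2 + (n2 + 1) * F) + P2)
        (a1 @ q1 @ xs @ s) (a2 @ q2 @ s)" by blast
  have "collects B (length (x # xs) * (n2 + n2 * F) +
      (\<Sum>x\<leftarrow>x # xs. size_in (Suc x) c) * (1 + n2 + (n2 + 1) * F) + (P1 + P2))
      (a @ q @ (x # xs) @ s) (a2 @ q2 @ s)"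
    using collects_trans[OF 1(4) 2(4)] by (simp add: algebra_simps)
  moreover have "max 1 (length a2) + (P1 + P2) \<le> max 1 (length a) + length (x # xs)"
    using 1(3) 2(3) by simp
  ultimately show ?case using 2(1,2) by blast
qed

lemma n1_pos: "1 \<le> n1"
  using size_in_Suc[OF bounds(2)] e_gt_1[of b] bounds by simp

lemma pairs_collect_layer:
  assumes F': "\<And>E P. 2 * E + n1 \<le> n1 * n1 \<Longrightarrow> P < 2 * n1 \<Longrightarrow>
      n1 * (n2 + n2 * F) + E * (1 + n2 + (n2 + 1) * F) + P + F \<le> F'"
    and L': "2 * n1 + n1 * n2 + 2 * (n2 * n2) + L \<le> L'"
  shows "pairs_collect b F' L'"
  unfolding pairs_collect_def
proof (intro allI impI)
  fix u w assume u: "normal_in b (Suc m) u" and w: "normal_in b (Suc m) w"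
  obtain a q where a: "u = a @ q" "shallow a" "deep q" using normal_in_split[OF u] by blast
  obtain xs p where x: "w = xs @ p" "shallow xs" "deep p" using normal_in_split[OF w] by blast
  let ?E = "\<Sum>x\<leftarrow>xs. size_in (Suc x) c"
  have "length xs + length p \<le> n1 + n2" using x shallow_length[of xs] deep_length[of p] by simp
  from insert_letters[OF a(2,3) normal_inD(1)[OF x(2)] this L'] obtain a1 q1 P where
    1: "shallow a1" "deep q1" "max 1 (length a1) + P \<le> max 1 (length a) + length xs"
      "collects L' (length xs * (n2 + n2 * F) + ?E * (1 + n2 + (n2 + 1) * F) + P)
        (a @ q @ xs @ p) (a1 @ q1 @ p)" by blast
  have "length a1 + L + length [p] * n2 + length [] \<le> L'"
    using shallow_length[OF 1(1)] L' n1_pos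
    by (cases n1) auto
  from collect_deep_words[OF 1(1,2) _ this] x(3) obtain z where
    z: "deep z" "collects L' F (a1 @ q1 @ p) (a1 @ z)" by auto
  have "P < 2 * n1" using 1(3) n1_pos shallow_length[OF a(2)] shallow_length[OF x(2)] by auto
  then have "n1 * (n2 + n2 * F) + ?E * (1 + n2 + (n2 + 1) * F) + P + F \<le> F'"
    using crossings_le[OF x(2)] bounds by (intro F') auto
  moreover have "length xs * (n2 + n2 * F) \<le> n1 * (n2 + n2 * F)"
    using shallow_length[OF x(2)] by (rule mult_le_mono1)
  ultimately have "length xs * (n2 + n2 * F) + ?E * (1 + n2 + (n2 + 1) * F) + P + F \<le> F'" by linarith
  with collects_trans[OF 1(4) z(2)] have "collects L' F' (u @ w) (a1 @ z)"
    using a(1) x(1) by (auto elim: collects_mono)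
  moreover have "normal_in b (Suc m) (a1 @ z)"
    using normal_in_append[OF 1(1) z(1)] bounds by simp
  ultimately show "\<exists>z. normal_in b (Suc m) z \<and> collects L' F' (u @ w) z" by blast
qed

end

section \<open>Induction over the layers\<close>

text \<open>The exchanges and power steps of a single layer; the cases \<open>n \<le> 2\<close> use the strictness of \<open>P < 2 * n\<close>.\<close>

lemma abelian_steps_arith:
  fixes n E P :: nat
  assumes "1 \<le> n" "2 * E + n \<le> n * n" "P < 2 * n"
  shows "E + P \<le> n * n"
proof -
  consider "n = 1" | "n = 2" | "3 \<le> n" using assms(1) by linarith
  then show ?thesis
  proof cases
    case 3
    then have "3 * n \<le> n * n" by (rule mult_le_mono1)
    then show ?thesis using assms by linarith
  qed (use assms in auto)
qed

lemma layer_steps_arith: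
  fixes n1 n2 E P F :: nat
  assumes "1 \<le> n1" "1 \<le> n2" "1 \<le> F" "2 * E + n1 \<le> n1 * n1" "P < 2 * n1"
  shows "n1 * (n2 + n2 * F) + E * (1 + n2 + (n2 + 1) * F) + P + F \<le> F * (n1 + n2) ^ 3"
proof -
  define K where "K = n1 * n2 + E * (n2 + 1)"
  have "(2 * E + n1) * (n2 + 1) \<le> n1 * n1 * (n2 + 1)" using assms(4) by (rule mult_le_mono1)
  then have "2 * K + P + 1 \<le> n1 * n2 + n1 * n1 * n2 + n1 * n1 + n1"
    using assms(5) unfolding K_def by (simp add: algebra_simps)
  also have "\<dots> \<le> n1 * (n2 * n2) + n1 * n1 * n2 + n1 * n1 * n2 + n1 * n1 * n2"
  proof -
    have "n1 * n2 \<le> n1 * (n2 * n2)" "n1 * n1 \<le> n1 * n1 * n2" "n1 \<le> n1 * n1 * n2"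
      using assms(1,2) by auto
    then show ?thesis by linarith
  qed
  also have "\<dots> \<le> (n1 + n2) ^ 3"
    by (simp add: power3_eq_cube algebra_simps)
  finally have "F * (2 * K + P + 1) \<le> F * (n1 + n2) ^ 3" by (rule mult_le_mono2)
  moreover have "n1 * (n2 + n2 * F) + E * (1 + n2 + (n2 + 1) * F) + P + F = K + P + F * K + F"
    unfolding K_def by (simp add: algebra_simps)
  moreover have "K \<le> F * K" "P \<le> F * P" using assms(3) by auto
  moreover have "F * (2 * K + P + 1) = F * K + F * K + F * P + F" by (simp add: algebra_simps)
  ultimately show ?thesis by linarith
qed

lemma layer_length_arith:
  fixes n1 n2 j :: nat
  assumes "1 \<le> n1"
  shows "2 * n1 + n1 * n2 + 2 * (n2 * n2) + 2 * n2 \<le> 2 * (n1 + n2) ^ 2"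
    and "1 \<le> j \<Longrightarrow> 2 * n1 + n1 * n2 + 2 * (n2 * n2) + 2 * (j - 1) * n2 ^ 2 \<le> 2 * j * (n1 + n2) ^ 2"
proof -
  obtain k where "n1 = Suc k" using assms by (cases n1) auto
  then show *: "2 * n1 + n1 * n2 + 2 * (n2 * n2) + 2 * n2 \<le> 2 * (n1 + n2) ^ 2"
    by (simp add: power2_eq_square algebra_simps)
  assume "1 \<le> j"
  then obtain i where i: "j = Suc i" by (cases j) auto
  have "2 * i * n2 ^ 2 \<le> 2 * i * (n1 + n2) ^ 2"
    by (intro mult_le_mono2 power_mono) auto
  moreover have "2 * j * (n1 + n2) ^ 2 = 2 * (n1 + n2) ^ 2 + 2 * i * (n1 + n2) ^ 2"
    unfolding i by (simp only: mult_Suc_right add_mult_distrib)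
  ultimately show "2 * n1 + n1 * n2 + 2 * (n2 * n2) + 2 * (j - 1) * n2 ^ 2 \<le> 2 * j * (n1 + n2) ^ 2"
    using * unfolding i diff_Suc_1 by linarith
qed

locale favourable_pc = pc +
  fixes d :: nat and \<delta> :: "nat \<Rightarrow> nat"
  assumes mono_\<delta>: "mono_on {1..m} \<delta>" and image_\<delta>: "\<delta> ` {1..m} = {1..d}"
    and v_normal: "1 \<le> i \<Longrightarrow> i \<le> j \<Longrightarrow> j \<le> m \<Longrightarrow> normal_in 1 (Suc m) (v i j)"
    and v_power: "i \<in> {1..m} \<Longrightarrow> i < m \<and> v i i = [i + 1] \<or> (\<forall>k \<in> set (v i i). \<delta> i < \<delta> k)"
    and v_conjugate: "1 \<le> i \<Longrightarrow> i < j \<Longrightarrow> j \<le> m \<Longrightarrow>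
      \<exists>w. normal_in 1 (Suc m) w \<and> (\<forall>k \<in> set w. \<delta> i < \<delta> k) \<and> (v i j = w \<or> v i j = j # w)"
begin

lemma layer_start_exists: "\<exists>c. 1 \<le> c \<and> c \<le> Suc m \<and> (\<forall>i \<in> {1..m}. t < \<delta> i \<longleftrightarrow> c \<le> i)"
proof -
  define Q where "Q i \<longleftrightarrow> i = Suc m \<or> i \<in> {1..m} \<and> t < \<delta> i" for i
  define c where "c = (LEAST i. Q i)"
  have "Q (Suc m)" by (simp add: Q_def)
  then have c: "Q c" "c \<le> Suc m" and least: "\<And>i. Q i \<Longrightarrow> c \<le> i"
    unfolding c_def by (auto intro: LeastI Least_le)
  have "t < \<delta> i \<longleftrightarrow> c \<le> i" if i: "i \<in> {1..m}" for i
  proof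
    assume "c \<le> i"
    then have "c \<in> {1..m}" "t < \<delta> c" using c i unfolding Q_def by auto
    then show "t < \<delta> i" using monotone_onD[OF mono_\<delta> _ i \<open>c \<le> i\<close>] by simp
  qed (use least i in \<open>simp add: Q_def\<close>)
  then show ?thesis using c by (intro exI[of _ c]) (auto simp: Q_def)
qed

text \<open>
  Induction on the number \<open>j\<close> of deepest layers taken into account; \<open>b\<close> is their first letter. The value
  at \<open>j = 0\<close>, where only the empty word is left, starts the induction, so that the deepest
  layer is treated like all others.
\<close>

lemma pairs_collect_layers:
  assumes "j \<le> d" "1 \<le> b" "b \<le> Suc m" "\<forall>i \<in> {1..m}. d - j < \<delta> i \<longleftrightarrow> b \<le> i"
  shows "pairs_collect b
    (if j = 0 then 0 else size_in b (Suc m) ^ (3 * j - 1))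
    (if j = 0 then 0 else if j = 1 then 2 * size_in b (Suc m) else 2 * (j - 1) * size_in b (Suc m) ^ 2)"
  using assms
proof (induction j arbitrary: b)
  case 0
  have "b = Suc m"
  proof (rule ccontr)
    assume "b \<noteq> Suc m"
    then have "m \<in> {1..m}" "b \<le> m" using 0 by auto
    then have "d < \<delta> m" using 0(4) by auto
    moreover have "\<delta> m \<in> {1..d}" using image_\<delta> \<open>m \<in> {1..m}\<close> by blast
    ultimately show False by simp
  qed
  then show ?case unfolding pairs_collect_def normal_in_def by (auto intro: collects.refl)
next
  case (Suc j)
  obtain c where c: "1 \<le> c" "c \<le> Suc m" "\<forall>i \<in> {1..m}. d - j < \<delta> i \<longleftrightarrow> c \<le> i"
    using layer_start_exists by blast
  define F where "F = (if j = 0 then 0 else size_in c (Suc m) ^ (3 * j - 1))"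
  define L where "L = (if j = 0 then 0 else if j = 1 then 2 * size_in c (Suc m)
    else 2 * (j - 1) * size_in c (Suc m) ^ 2)"
  have pairs: "pairs_collect c F L"
    unfolding F_def L_def using Suc.IH[OF _ c] Suc.prems(1) by simp
  have val: "\<delta> i = d - j" if "i \<in> {b..<c}" for i
  proof -
    have "i \<in> {1..m}" "b \<le> i" "\<not> c \<le> i" using that Suc.prems(2) c(2) by auto
    then have "d - Suc j < \<delta> i" "\<not> d - j < \<delta> i" using Suc.prems(4) c(3) by auto
    then show ?thesis using Suc.prems(1) by linarith
  qed
  have upper: "set w \<subseteq> {c..<Suc m}" if "i \<in> {b..<c}" "normal_in 1 (Suc m) w" "\<forall>k \<in> set w. \<delta> i < \<delta> k" for i w
    using normal_inD(1)[OF that(2)] that(3) val[OF that(1)] c(3) by fastforce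
  have normal_upper: "normal_in c (Suc m) w" if "normal_in 1 (Suc m) w" "set w \<subseteq> {c..<Suc m}" for w
    using that unfolding normal_in_def by blast
  have zero: "size_in c (Suc m) = 0" if "j = 0"
  proof -
    have "c = Suc m"
    proof (rule ccontr)
      assume "c \<noteq> Suc m"
      then have "m \<in> {1..m}" "c \<le> m" using c by auto
      then have "d < \<delta> m" using c(3) that by auto
      moreover have "\<delta> m \<in> {1..d}" using image_\<delta> \<open>m \<in> {1..m}\<close> by blast
      ultimately show False by simp
    qed
    then show ?thesis by (simp add: size_in_def)
  qed
  have pos: "1 \<le> size_in c (Suc m)" if "j \<noteq> 0"
  proof -
    have "d \<in> {1..d}" using Suc.prems(1) by simp
    then obtain i where i: "i \<in> {1..m}" "\<delta> i = d" using image_\<delta> by (metis imageE)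
    then have "c \<le> m" using c(3) that Suc.prems(1) by fastforce
    then show ?thesis using size_in_Suc[of c "Suc m"] e_gt_1[of c] c(1) by simp
  qed
  interpret layer m e v b c F L
  proof unfold_locales
    show "1 \<le> b" "c \<le> Suc m" by fact+
    have "d - j \<in> {1..d}" using Suc.prems(1) by simp
    then obtain i where i: "i \<in> {1..m}" "\<delta> i = d - j" using image_\<delta> by (metis imageE)
    have "d - Suc j < \<delta> i" "\<not> d - j < \<delta> i" using i(2) Suc.prems(1) by simp_all
    then have "b \<le> i" "\<not> c \<le> i" using bspec[OF Suc.prems(4) i(1)] bspec[OF c(3) i(1)] by blast+
    then show "b < c" by simp
    show "pairs_collect c F L" by fact
    show "2 * size_in c (Suc m) \<le> L"
    proof -
      consider "j = 0" | "j = 1" | k where "j = Suc (Suc k)" by (metis One_nat_def not0_implies_Suc)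
      then show ?thesis
      proof cases
        case 1
        then show ?thesis using zero by simp
      next
        case 2
        then show ?thesis by (simp add: L_def)
      next
        case 3
        have "2 * size_in c (Suc m) \<le> 2 * size_in c (Suc m) ^ 2" by (simp add: power2_eq_square)
        also have "\<dots> \<le> L" using 3 by (simp add: L_def)
        finally show ?thesis .
      qed
    qed
  next
    fix i assume i: "i \<in> {b..<c}"
    then have im: "i \<in> {1..m}" using Suc.prems(2) c(2) by auto
    then have n: "normal_in 1 (Suc m) (v i i)" using v_normal by simp
    from v_power[OF im] show "Suc i < c \<and> v i i = [Suc i] \<or> normal_in c (Suc m) (v i i)"
    proof
      assume *: "i < m \<and> v i i = [i + 1]"
      then show ?thesis using i normal_upper[OF n] by (cases "Suc i < c") auto
    qed (use normal_upper[OF n] upper[OF i n] in blast)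
  next
    fix i j assume i: "i \<in> {b..<c}" and j: "j \<in> {i<..<c}"
    then have "1 \<le> i" "i < j" "j \<le> m" using Suc.prems(2) c(2) by auto
    from v_conjugate[OF this]
    show "\<exists>w. normal_in c (Suc m) w \<and> (v i j = w \<or> v i j = j # w)"
      using upper[OF i] normal_upper by blast
  next
    fix i j assume i: "i \<in> {b..<c}" and j: "j \<in> {c..<Suc m}"
    then have ij: "1 \<le> i" "i < j" "j \<le> m" using Suc.prems(2) by auto
    then have n: "normal_in 1 (Suc m) (v i j)" by (intro v_normal) auto
    obtain w where w: "normal_in 1 (Suc m) w" "\<forall>k \<in> set w. \<delta> i < \<delta> k" "v i j = w \<or> v i j = j # w"
      using v_conjugate[OF ij] by blast
    then have "set (v i j) \<subseteq> {c..<Suc m}" using upper[OF i w(1,2)] j by auto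
    then show "normal_in c (Suc m) (v i j)" using normal_upper[OF n] by blast
  qed
  have N: "size_in b (Suc m) = n1 + n2"
    using size_in_split[of b c "Suc m"] bounds by simp
  have "pairs_collect b ((n1 + n2) ^ (3 * Suc j - 1))
    (if Suc j = 1 then 2 * (n1 + n2) else 2 * (Suc j - 1) * (n1 + n2) ^ 2)"
  proof (rule pairs_collect_layer)
    fix E P assume EP: "2 * E + n1 \<le> n1 * n1" "P < 2 * n1"
    show "n1 * (n2 + n2 * F) + E * (1 + n2 + (n2 + 1) * F) + P + F \<le> (n1 + n2) ^ (3 * Suc j - 1)"
    proof (cases "j = 0")
      case True
      then have "n2 = 0" "F = 0" "3 * Suc j - 1 = 2" using zero by (simp_all add: F_def)
      then show ?thesis using abelian_steps_arith[OF n1_pos EP] by (simp only: power2_eq_square) simp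
    next
      case False
      then have "1 \<le> F" using pos unfolding F_def by simp
      from layer_steps_arith[OF n1_pos pos[OF False] this EP]
      have "n1 * (n2 + n2 * F) + E * (1 + n2 + (n2 + 1) * F) + P + F \<le> F * (n1 + n2) ^ 3" .
      also have "\<dots> \<le> (n1 + n2) ^ (3 * j - 1) * (n1 + n2) ^ 3"
        using False unfolding F_def by (intro mult_le_mono1) (simp add: power_mono)
      also have "\<dots> = (n1 + n2) ^ (3 * Suc j - 1)"
        using False by (simp add: power_add[symmetric])
      finally show ?thesis .
    qed
  next
    show "2 * n1 + n1 * n2 + 2 * (n2 * n2) + L \<le>
      (if Suc j = 1 then 2 * (n1 + n2) else 2 * (Suc j - 1) * (n1 + n2) ^ 2)"
    proof -
      consider "j = 0" | "j = 1" | "2 \<le> j" by linarith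
      then show ?thesis
      proof cases
        case 1
        then show ?thesis using zero by (simp add: L_def)
      next
        case 2
        then show ?thesis using layer_length_arith(1)[OF n1_pos] by (simp add: L_def)
      next
        case 3
        then have "L = 2 * (j - 1) * n2 ^ 2" "Suc j \<noteq> 1" "1 \<le> j" by (simp_all add: L_def)
        then show ?thesis using layer_length_arith(2)[OF n1_pos, of j n2] by (simp only: if_False diff_Suc_1)
      qed
    qed
  qed
  then show ?case unfolding N by simp
qed

end

theorem mainTheorem1:
  fixes m d N :: nat and e :: "nat \<Rightarrow> nat" and v :: "nat \<Rightarrow> nat \<Rightarrow> word"
  assumes "favourable m e v d"
    and "consistent m e v"
    and "\<forall>i\<in>{1..m}. e i > 1"
    and "N = max_normal_length m e"
    and "u \<in> normal_words m e"
    and "w \<in> normal_words m e"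
  shows "\<exists>n (W :: nat \<Rightarrow> word).
    W 0 = u @ w \<and>
    (\<forall>k<n. left_collection_step m e v (W k) (W (Suc k))) \<and>
    W n \<in> normal_words m e \<and>
    n \<le> N ^ (3 * d - 1) \<and>
    (\<forall>k\<le>n. length (W k) \<le> (if d = 1 then 2 * N else 2 * (d - 1) * N ^ 2))"
proof -
  have pres: "pc_presentation m e v" and d: "0 < d"
    using assms(1) unfolding favourable_def by auto
  obtain \<delta> :: "nat \<Rightarrow> nat" where \<delta>: "mono_on {1..m} \<delta>" "\<delta> ` {1..m} = {1..d}"
    and pow: "\<forall>i\<in>{1..m}. (i < m \<and> v i i = [i + 1]) \<or>
        (v i i \<in> normal_words m e \<and> (\<forall>k\<in>set (v i i). \<delta> k > \<delta> i))"
    and con: "\<forall>i j. 1 \<le> i \<and> i < j \<and> j \<le> m \<longrightarrow> v i j \<in> normal_words m e \<and>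
        (\<exists>v' \<in> normal_words m e. (\<forall>k\<in>set v'. \<delta> k > \<delta> i) \<and> (v i j = v' \<or> v i j = j # v'))"
    using assms(1) unfolding favourable_def by blast
  interpret pc m e v
    using assms(3) pres unfolding pc_presentation_def by unfold_locales auto
  interpret favourable_pc m e v d \<delta>
  proof unfold_locales
    fix i j assume ij: "1 \<le> i" "i \<le> j" "j \<le> m"
    show "normal_in 1 (Suc m) (v i j)"
    proof (cases "i = j")
      case True
      then have "(replicate (e i) i, v i j) \<in> pc_relations m e v"
        using ij unfolding pc_relations_def by auto
      then show ?thesis using pres normal_words_eq unfolding pc_presentation_def by blast
    qed (use con ij normal_words_eq in auto)
  next
    show "mono_on {1..m} \<delta>" "\<delta> ` {1..m} = {1..d}" by fact+
  next
    show "i < m \<and> v i i = [i + 1] \<or> (\<forall>k\<in>set (v i i). \<delta> i < \<delta> k)" if "i \<in> {1..m}" for i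
      using pow that by blast
  next
    fix i j assume "1 \<le> i" "i < j" "j \<le> m"
    then obtain w where "w \<in> normal_words m e" "\<forall>k\<in>set w. \<delta> i < \<delta> k" "v i j = w \<or> v i j = j # w"
      using con by blast
    then show "\<exists>w. normal_in 1 (Suc m) w \<and> (\<forall>k\<in>set w. \<delta> i < \<delta> k) \<and> (v i j = w \<or> v i j = j # w)"
      unfolding normal_words_eq by blast
  qed
  have N: "size_in 1 (Suc m) = N"
    unfolding assms(4) size_in_def max_normal_length_def atLeastLessThanSuc_atLeastAtMost ..
  have "\<forall>i \<in> {1..m}. d - d < \<delta> i \<longleftrightarrow> 1 \<le> i" using \<delta>(2) by fastforce
  from pairs_collect_layers[OF order_refl order_refl _ this] d
  have "pairs_collect 1 (N ^ (3 * d - 1)) (if d = 1 then 2 * N else 2 * (d - 1) * N ^ 2)"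
    unfolding N by simp
  then obtain z where z: "normal_in 1 (Suc m) z"
    "collects (if d = 1 then 2 * N else 2 * (d - 1) * N ^ 2) (N ^ (3 * d - 1)) (u @ w) z"
    using assms(5,6) unfolding pairs_collect_def normal_words_eq by blast
  from collects_sequence[OF z(2)] z(1) show ?thesis
    unfolding normal_words_eq by blast
qed

end
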